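(* For any $m,m'\in\mathbb N$ with $m'\ge m$, $\Lambda_{\mathscr F_{m'},\overline{\mathcal P}_{\le m}}\le\frac{2m'}{m}$. Moreover, for any $\delta\in(0,\frac12]$ there exist a bid history $\mathcal H$ and valuation vector $\mathbf v$ such that $\Lambda_{\mathscr F_{m'},\overline{\mathcal P}_{\le m}}(\mathcal H,\mathbf v)\ge\frac{2m'}{m}-\delta$. Thus the richness ratio of $\mathscr F_{m'}$ is $\alpha=m/(2m')$.
   Context: Uniform price auction with $K$ identical units, repeated over a finite bid history $\mathcal H=[\boldsymbol\beta_-^t]_{t\in[T]}$ of competing bids. A bidder has valuation $\mathbf v$: $v_1\ge\dots\ge v_M>0$, $w_j=\frac1j\sum_{\ell\le j}v_\ell$. An $m$-uniform strategy $\langle(b_1,q_1),\dots,(b_m,q_m)\rangle$ ($b_1>\dots>b_m>0$, positive integer $q_j$, $Q_j=\sum_{\ell\le j}q_\ell\le M$) is the bid vector with $q_1$ copies of $b_1$, then $q_2$ copies of $b_2$, etc. With competing bids $\boldsymbol\beta_-$, the $K$ highest bids win a unit each (ties in favor of the bidder), $x$ is the bidder's number of winning bids, the price $p$ is the $K$-th highest bid, $V(\mathbf b;\boldsymbol\beta_-)=\sum_{j\le x}v_j$, $P=px$. $\overline{\mathcal P}_{\le m}$ is the set of $k$-uniform strategies, $k\le m$, with $b_\ell=w_{Q_\ell}$ for all $\ell$. $\mathscr F_{m'}=\mathscr F_{m'}(\mathcal H)$ is the class of $k$-uniform strategies with $k\le m'$ that are RoI feasible ($V\ge P$) in every round of $\mathcal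 H$. $\Lambda_{\mathscr B_c,\mathscr B}(\mathcal H,\mathbf v)=\frac{\max_{\mathbf b\in\mathscr B_c}\sum_tV(\mathbf b;\boldsymbol\beta_-^t)}{\max_{\mathbf b'\in\mathscr B}\sum_tV(\mathbf b';\boldsymbol\beta_-^t)}$, and $\Lambda_{\mathscr B_c,\mathscr B}$ is the supremum over all valuation vectors and bid histories of arbitrary length. If $\Lambda_{\mathscr B_c,\overline{\mathcal P}_{\le m}}\le\lambda$ and for every small $\delta>0$ some $(\mathcal H,\mathbf v)$ attains $\ge\lambda-\delta$, the richness ratio of $\mathscr B_c$ is $\alpha=1/\lambda$. *)

theory Defs
  imports Complex_Main "HOL-Library.Extended_Real"
begin

text \<open>
  Lists are indexed from 0, so the entry with index \<open>l\<close> is the \<open>(l + 1)\<close>-st entry in the usual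
  numbering.  The maximal demand \<open>M\<close> of the bidder is the length of the valuation vector \<open>v\<close>.
\<close>

definition valuation :: "real list \<Rightarrow> bool" where
  "valuation v \<longleftrightarrow> v \<noteq> [] \<and> sorted_wrt (\<ge>) v \<and> (\<forall>x\<in>set v. x > 0)"

definition avg_value :: "real list \<Rightarrow> nat \<Rightarrow> real" where
  "avg_value v j = (\<Sum>l<j. v ! l) / real j"

text \<open>
  A history lists, for each round, the bids submitted by the competitors, in any order.
\<close>

definition bid_history :: "real list list \<Rightarrow> bool" where
  "bid_history H \<longleftrightarrow> H \<noteq> [] \<and> (\<forall>\<beta>\<in>set H. \<forall>c\<in>set \<beta>. c \<ge> 0)"

section \<open>Uniform strategies\<close>

type_synonym strategy = "(real \<times> nat) list"

definition quantity_upto :: "strategy \<Rightarrow> nat \<Rightarrow> nat" where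
  "quantity_upto s j = (\<Sum>l<j. snd (s ! l))"

definition uniform_strategy :: "nat \<Rightarrow> nat \<Rightarrow> strategy \<Rightarrow> bool" where
  "uniform_strategy M k s \<longleftrightarrow>
     k \<ge> 1 \<and> length s = k \<and>
     sorted_wrt (>) (map fst s) \<and>
     (\<forall>(b, q)\<in>set s. b > 0 \<and> q > 0) \<and>
     quantity_upto s k \<le> M"

definition bid_vector :: "strategy \<Rightarrow> real list" where
  "bid_vector s = concat (map (\<lambda>(b, q). replicate q b) s)"

section \<open>The auction\<close>

text \<open>
  All bids in decreasing order; the flag marks the bids of the bidder.  Since \<^const>\<open>sort_key\<close> is
  stable and the bidder's bids come first in its argument, ties are broken in favor of the bidder.
\<close>

definition ranking :: "real list \<Rightarrow> real list \<Rightarrow> (real \<times> bool) list" where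
  "ranking bs \<beta> =
     sort_key (\<lambda>(c, own). - c) (map (\<lambda>c. (c, True)) bs @ map (\<lambda>c. (c, False)) \<beta>)"

definition units_won :: "nat \<Rightarrow> real list \<Rightarrow> real list \<Rightarrow> nat" where
  "units_won K bs \<beta> = length (filter snd (take K (ranking bs \<beta>)))"

text \<open>
  If fewer than \<open>K\<close> bids are submitted in total, missing bids count as 0, so the price is 0.
\<close>

definition price :: "nat \<Rightarrow> real list \<Rightarrow> real list \<Rightarrow> real" where
  "price K bs \<beta> =
     (if K \<le> length (ranking bs \<beta>) then fst (ranking bs \<beta> ! (K - 1)) else 0)"

definition obtained_value :: "nat \<Rightarrow> real list \<Rightarrow> strategy \<Rightarrow> real list \<Rightarrow> real" where
  "obtained_value K v s \<beta> = (\<Sum>j<units_won K (bid_vector s) \<beta>. v ! j)"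

definition payment :: "nat \<Rightarrow> strategy \<Rightarrow> real list \<Rightarrow> real" where
  "payment K s \<beta> = price K (bid_vector s) \<beta> * real (units_won K (bid_vector s) \<beta>)"

section \<open>Strategy classes\<close>

text \<open>
  A strategy class may depend on the number \<open>K\<close> of units, the valuation vector and the history.
\<close>

type_synonym strategy_class = "nat \<Rightarrow> real list \<Rightarrow> real list list \<Rightarrow> strategy set"

definition safe_class :: "nat \<Rightarrow> strategy_class" where
  "safe_class m K v H =
     {s. \<exists>k\<le>m. uniform_strategy (length v) k s \<and>
          (\<forall>l<k. fst (s ! l) = avg_value v (quantity_upto s (Suc l)))}"

definition roi_feasible_class :: "nat \<Rightarrow> strategy_class" where
  "roi_feasible_class m K v H =
     {s. \<exists>k\<le>m. uniform_strategy (length v) k s \<and>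
          (\<forall>\<beta>\<in>set H. obtained_value K v s \<beta> \<ge> payment K s \<beta>)}"

section \<open>Value ratio and richness ratio\<close>

definition total_value :: "nat \<Rightarrow> real list \<Rightarrow> real list list \<Rightarrow> strategy \<Rightarrow> real" where
  "total_value K v H s = (\<Sum>t<length H. obtained_value K v s (H ! t))"

text \<open>
  Total values take only finitely many values for fixed \<open>K\<close>, \<open>v\<close> and \<open>H\<close>, so \<^const>\<open>Max\<close> is
  appropriate for nonempty classes.
\<close>

definition best_value :: "strategy_class \<Rightarrow> nat \<Rightarrow> real list \<Rightarrow> real list list \<Rightarrow> real" where
  "best_value B K v H = Max (total_value K v H ` B K v H)"

definition value_ratio ::
    "strategy_class \<Rightarrow> strategy_class \<Rightarrow> nat \<Rightarrow> real list \<Rightarrow> real list list \<Rightarrow> real" where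
  "value_ratio Bc B K v H = best_value Bc K v H / best_value B K v H"

definition auction_instance :: "nat \<Rightarrow> real list \<Rightarrow> real list list \<Rightarrow> bool" where
  "auction_instance K v H \<longleftrightarrow> K \<ge> 1 \<and> valuation v \<and> bid_history H"

text \<open>
  The supremum also ranges over the market size, that is, over \<open>K\<close> and \<open>M = length v\<close>.  It is taken
  in the extended reals, so that it is infinite when the ratios are unbounded.  A ratio \<open>0 / 0\<close>,
  which arises if no unit can be won at a price of at most \<open>v ! 0\<close>, counts as 0.
\<close>

definition worst_case_ratio :: "strategy_class \<Rightarrow> strategy_class \<Rightarrow> ereal" where
  "worst_case_ratio Bc B =
     Sup {ereal (value_ratio Bc B K v H) | K v H. auction_instance K v H}"

definition richness_ratio :: "strategy_class \<Rightarrow> nat \<Rightarrow> real \<Rightarrow> bool" where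
  "richness_ratio Bc m \<alpha> \<longleftrightarrow>
     (\<exists>r>0. \<alpha> = 1 / r \<and>
        worst_case_ratio Bc (safe_class m) \<le> ereal r \<and>
        (\<exists>\<delta>0>0. \<forall>\<delta>. 0 < \<delta> \<and> \<delta> \<le> \<delta>0 \<longrightarrow>
           (\<exists>K v H. auction_instance K v H \<and> value_ratio Bc (safe_class m) K v H \<ge> r - \<delta>)))"

end

(*
  Upper bound.  If the bidder wins x > 0 units at price p, then at most K - x competing bids exceed p,
  and RoI feasibility says p <= w_x.  So a bid w_y >= p for y >= x units wins at least x units as well.
  A k-uniform strategy needs only 2k such quantities y, hence some safe strategy with m of them
  retains a fraction m / (2k) of the value.

  Tightness.  With values 2, 1, 1, ... the averages are strictly decreasing, and with quantities N^g,
  g = 1, ..., 2m', in groups of N^(2m' - g) rounds, a safe level earns a non-negligible share in one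
  group only.  An RoI feasible block serves two groups: one in which it wins partially and sets the
  price, and one in which it wins completely at a price below its bid.
*)
theory Submission imports Defs "HOL-Library.Multiset" begin

text \<open>What separates the two classes is the coupling of bid and quantity. A safe block that
  ends at cumulative quantity \<open>y\<close> must bid \<open>avg_value v y\<close>, so a single
  number describes it. RoI feasibility constrains the price only by the average at the quantity
  actually won. A block may therefore bid more than the average at its own end, provided that the
  history never makes it pay too much for the units it wins. Each block thus has two relevant
  quantities: its end, and the largest quantity won at a price equal to its bid. They need not
  coincide, and this is the source of the factor 2. The hard instance makes both of them matter for
  every block, and equally much. The auction enters the later parts through counts of bids above a
  threshold rather than through positions in the ranking.\<close>

section \<open>Counting bids in the ranking\<close>

abbreviation num :: "('a \<Rightarrow> bool) \<Rightarrow> 'a list \<Rightarrow> nat" where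
  "num P xs \<equiv> length (filter P xs)"

text \<open>The order of the ranking with the tie rule built in, so that sortedness alone says that
  an own bid precedes an equal competing bid.\<close>

definition ranked_before :: "real \<times> bool \<Rightarrow> real \<times> bool \<Rightarrow> bool" where
  "ranked_before a b \<longleftrightarrow> fst a > fst b \<or> fst a = fst b \<and> (snd b \<longrightarrow> snd a)"

lemma sorted_wrt_insort_own:
  assumes "sorted_wrt ranked_before xs" "snd a"
  shows "sorted_wrt ranked_before (insort_key (\<lambda>(c, own). - c) a xs)"
  using assms
proof (induction xs)
  case Nil
  then show ?case by simp
next
  case (Cons b xs)
  then show ?case
    by (auto simp: ranked_before_def set_insort_key case_prod_beta)
qed

text \<open>The sort inserts from the right end of the list: the competing bids are sorted first,
  then each own bid is inserted in front of all equal bids. This suggests induction on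
  \<open>bs\<close>.\<close>

lemma sorted_ranking: "sorted_wrt ranked_before (ranking bs \<beta>)"
proof (induction bs)
  case Nil
  have "sorted (map (\<lambda>(c, own). - c) (ranking [] \<beta>))"
    by (simp add: ranking_def)
  then have "sorted_wrt (\<lambda>a b. fst b \<le> fst a) (ranking [] \<beta>)"
    by (simp add: sorted_map case_prod_beta)
  moreover have "\<forall>a\<in>set (ranking [] \<beta>). \<not> snd a"
    by (auto simp: ranking_def)
  ultimately show ?case
    by (elim sorted_wrt_mono_rel[rotated]) (auto simp: ranked_before_def)
next
  case (Cons b bs)
  then show ?case
    using sorted_wrt_insort_own[of "ranking bs \<beta>" "(b, True)"] by (simp add: ranking_def)
qed

lemma num_ranking:
  "num P (ranking bs \<beta>) = num (\<lambda>c. P (c, True)) bs + num (\<lambda>c. P (c, False)) \<beta>"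
proof -
  have filt: "num P xs = size (filter_mset P (mset xs))" for xs
    by (metis mset_filter size_mset)
  have "num P (ranking bs \<beta>) = size (filter_mset P (mset (ranking bs \<beta>)))"
    by (rule filt)
  also have "\<dots> = num P (map (\<lambda>c. (c, True)) bs @ map (\<lambda>c. (c, False)) \<beta>)"
    unfolding ranking_def mset_sort by (rule filt[symmetric])
  finally show ?thesis by (simp add: filter_map o_def)
qed

lemma num_take_drop: "num P xs = num P (take n xs) + num P (drop n xs)"
  by (metis append_take_drop_id filter_append length_append)

lemma ranked_before_take_drop:
  assumes "a \<in> set (take n (ranking bs \<beta>))" "b \<in> set (drop n (ranking bs \<beta>))"
  shows "ranked_before a b"
  using sorted_ranking[of bs \<beta>] assms
  by (metis append_take_drop_id sorted_wrt_append)

lemma num_mono: "(\<And>x. x \<in> set xs \<Longrightarrow> P x \<Longrightarrow> Q x) \<Longrightarrow> num P xs \<le> num Q xs"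
  by (induction xs) auto

lemma num_pos_iff: "0 < num P xs \<longleftrightarrow> (\<exists>x\<in>set xs. P x)"
  by (auto simp: filter_empty_conv)

lemma num_eq_0: "(\<And>x. x \<in> set xs \<Longrightarrow> \<not> P x) \<Longrightarrow> num P xs = 0"
  by (simp add: filter_empty_conv)

lemma num_conj_not: "num P xs + num (\<lambda>x. \<not> P x) xs = length xs"
  by (rule sum_length_filter_compl)

text \<open>If an own bid of at least \<open>r\<close> loses, the tie rule puts every winning
  competing bid strictly above \<open>r\<close>. There are at most \<open>K - x\<close> of those, so
  at least \<open>x\<close> units remain.\<close>

lemma units_won_ge:
  assumes "x \<le> num (\<lambda>c. r \<le> c) bs" "x + num (\<lambda>c. r < c) \<beta> \<le> K"
  shows "x \<le> units_won K bs \<beta>"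
proof (rule ccontr)
  let ?R = "ranking bs \<beta>"
  assume "\<not> ?thesis"
  then have less: "num snd (take K ?R) < x"
    by (simp add: units_won_def)
  let ?P = "\<lambda>a. snd a \<and> r \<le> fst a"
  have "num ?P ?R = num (\<lambda>c. r \<le> c) bs" by (simp add: num_ranking)
  moreover have "num ?P (take K ?R) \<le> num snd (take K ?R)" by (rule num_mono) auto
  ultimately have "0 < num ?P (drop K ?R)"
    using num_take_drop[of ?P ?R K] less assms(1) by linarith
  then obtain a where a: "a \<in> set (drop K ?R)" "?P a"
    unfolding num_pos_iff by blast
  then have len: "length (take K ?R) = K"
    by (cases "K \<le> length ?R") auto
  have "num (\<lambda>a. \<not> snd a) (take K ?R) \<le> num (\<lambda>a. \<not> snd a \<and> r < fst a) (take K ?R)"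
    by (rule num_mono) (use ranked_before_take_drop[OF _ a(1)] a(2) in \<open>force simp: ranked_before_def\<close>)
  also have "\<dots> \<le> num (\<lambda>a. \<not> snd a \<and> r < fst a) ?R"
    using num_take_drop[of _ ?R K] by (metis le_add1)
  also have "\<dots> = num (\<lambda>c. r < c) \<beta>" by (simp add: num_ranking)
  finally show False
    using less assms(2) len num_conj_not[of snd "take K ?R"] by linarith
qed

text \<open>An own bid below \<open>r\<close> comes after all \<open>K\<close> competing bids of at
  least \<open>r\<close>, hence wins nothing.\<close>

lemma units_won_le:
  assumes "K \<le> num (\<lambda>c. r \<le> c) \<beta>"
  shows "units_won K bs \<beta> \<le> num (\<lambda>c. r \<le> c) bs"
proof (rule ccontr)
  let ?R = "ranking bs \<beta>"
  let ?P = "\<lambda>a. snd a \<and> r \<le> fst a" and ?Q = "\<lambda>a. \<not> snd a \<and> r \<le> fst a"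
  assume "\<not> ?thesis"
  then have less: "num (\<lambda>c. r \<le> c) bs < num snd (take K ?R)"
    by (simp add: units_won_def)
  have "num ?P (take K ?R) \<le> num ?P ?R"
    using num_take_drop[of _ ?R K] by (metis le_add1)
  also have "\<dots> = num (\<lambda>c. r \<le> c) bs" by (simp add: num_ranking)
  finally have "\<not> num snd (take K ?R) \<le> num ?P (take K ?R)" using less by linarith
  then obtain a where a: "a \<in> set (take K ?R)" "snd a" "fst a < r"
    using num_mono[of "take K ?R" snd ?P] by force
  have "num ?Q (drop K ?R) = 0"
    by (rule num_eq_0) (use ranked_before_take_drop[OF a(1)] a in \<open>force simp: ranked_before_def\<close>)
  then have "K \<le> num ?Q (take K ?R)"
    using assms num_take_drop[of ?Q ?R K] by (simp add: num_ranking)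
  also have "\<dots> \<le> num (\<lambda>a. \<not> snd a) (take K ?R)" by (rule num_mono) auto
  finally show False
    using less num_conj_not[of snd "take K ?R"] by simp
qed

section \<open>The price as a threshold between winning and losing bids\<close>

lemma price_le_taken:
  assumes "K \<le> length (ranking bs \<beta>)" "a \<in> set (take K (ranking bs \<beta>))"
  shows "price K bs \<beta> \<le> fst a"
proof -
  let ?R = "ranking bs \<beta>"
  obtain i where i: "i < K" "a = ?R ! i"
    using assms by (auto simp: in_set_conv_nth)
  then show ?thesis
    using assms(1) sorted_ranking[of bs \<beta>] sorted_wrt_nth_less[of ranked_before ?R i "K - 1"]
    by (cases "i = K - 1") (force simp: price_def ranked_before_def)+
qed

lemma dropped_le_price:
  assumes "K \<ge> 1" "a \<in> set (drop K (ranking bs \<beta>))"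
  shows "fst a \<le> price K bs \<beta>"
proof -
  let ?R = "ranking bs \<beta>"
  obtain i where "i < length (drop K ?R)" "a = drop K ?R ! i"
    using assms(2) by (metis in_set_conv_nth)
  then have i: "K + i < length ?R" "a = ?R ! (K + i)" by simp_all
  then show ?thesis
    using assms(1) sorted_ranking[of bs \<beta>] sorted_wrt_nth_less[of ranked_before ?R "K - 1" "K + i"]
    by (force simp: price_def ranked_before_def)
qed

lemma units_won_le_num_ge_price:
  assumes "\<forall>b\<in>set bs. b \<ge> 0"
  shows "units_won K bs \<beta> \<le> num (\<lambda>c. price K bs \<beta> \<le> c) bs"
proof (cases "K \<le> length (ranking bs \<beta>)")
  case True
  let ?R = "ranking bs \<beta>"
  have "units_won K bs \<beta> \<le> num (\<lambda>a. snd a \<and> price K bs \<beta> \<le> fst a) (take K ?R)"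
    unfolding units_won_def by (rule num_mono) (use price_le_taken[OF True] in auto)
  also have "\<dots> \<le> num (\<lambda>a. snd a \<and> price K bs \<beta> \<le> fst a) ?R"
    using num_take_drop[of _ ?R K] by (metis le_add1)
  finally show ?thesis by (simp add: num_ranking)
next
  \<comment> \<open>With fewer than \<open>K\<close> bids every own bid wins at the default price 0,
    which no own bid falls below.\<close>
  case False
  then have "units_won K bs \<beta> = length bs"
    by (simp add: units_won_def num_ranking)
  then show ?thesis using False assms by (simp add: price_def)
qed

lemma num_gt_price_le_units_won:
  assumes "K \<ge> 1"
  shows "num (\<lambda>c. price K bs \<beta> < c) bs \<le> units_won K bs \<beta>"
proof -
  let ?R = "ranking bs \<beta>" and ?P = "\<lambda>a. snd a \<and> price K bs \<beta> < fst a"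
  have "num ?P (drop K ?R) = 0"
    by (rule num_eq_0) (use dropped_le_price[OF assms] in force)
  moreover have "num ?P (take K ?R) \<le> num snd (take K ?R)" by (rule num_mono) auto
  ultimately show ?thesis
    using num_take_drop[of ?P ?R K] by (simp add: num_ranking units_won_def)
qed

text \<open>A bid above the price cannot lose, so each such competing bid occupies a unit that the
  bidder does not win.\<close>

lemma units_won_add_num_gt_price:
  assumes "K \<ge> 1"
  shows "units_won K bs \<beta> + num (\<lambda>c. price K bs \<beta> < c) \<beta> \<le> K"
proof -
  let ?R = "ranking bs \<beta>" and ?P = "\<lambda>a. \<not> snd a \<and> price K bs \<beta> < fst a"
  have "num ?P (drop K ?R) = 0"
    by (rule num_eq_0) (use dropped_le_price[OF assms] in force)
  moreover have "num ?P (take K ?R) \<le> num (\<lambda>a. \<not> snd a) (take K ?R)" by (rule num_mono) auto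
  ultimately show ?thesis
    using num_take_drop[of ?P ?R K] num_conj_not[of snd "take K ?R"]
    by (simp add: num_ranking units_won_def)
qed

text \<open>Were the price above \<open>r\<close>, all \<open>K\<close> winning bids would be. The
  assumption \<open>r \<ge> 0\<close> covers the default price 0.\<close>

lemma price_le:
  assumes "K \<ge> 1" "r \<ge> 0" "num (\<lambda>c. r < c) bs + num (\<lambda>c. r < c) \<beta> < K"
  shows "price K bs \<beta> \<le> r"
proof (rule ccontr)
  let ?R = "ranking bs \<beta>"
  assume neg: "\<not> ?thesis"
  with assms(2) have len: "K \<le> length ?R" by (auto simp: price_def split: if_splits)
  have "length (take K ?R) = num (\<lambda>a. r < fst a) (take K ?R)"
    using price_le_taken[OF len] neg by (subst filter_True) force+
  also have "\<dots> \<le> num (\<lambda>a. r < fst a) ?R"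
    using num_take_drop[of _ ?R K] by (metis le_add1)
  finally show False using assms(3) len by (simp add: num_ranking)
qed

section \<open>Average values\<close>

abbreviation value_upto :: "real list \<Rightarrow> nat \<Rightarrow> real" where
  "value_upto v x \<equiv> \<Sum>j<x. v ! j"

lemma value_upto_eq_avg: "x > 0 \<Longrightarrow> value_upto v x = real x * avg_value v x"
  by (simp add: avg_value_def)

lemma value_upto_mono:
  assumes "valuation v" "i \<le> j" "j \<le> length v"
  shows "value_upto v i \<le> value_upto v j"
  using assms by (intro sum_mono2) (auto simp: valuation_def intro: less_imp_le)

lemma value_upto_nonneg:
  assumes "valuation v" "j \<le> length v"
  shows "0 \<le> value_upto v j"
  using assms by (intro sum_nonneg) (auto simp: valuation_def intro: less_imp_le)

lemma avg_value_pos: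
  assumes "valuation v" "0 < j" "j \<le> length v"
  shows "0 < avg_value v j"
  unfolding avg_value_def using assms
  by (intro divide_pos_pos sum_pos) (auto simp: valuation_def)

lemma avg_value_antimono:
  assumes v: "valuation v" and "0 < i" "i \<le> j" "j \<le> length v"
  shows "avg_value v j \<le> avg_value v i"
  using assms(3,4)
proof (induction j rule: dec_induct)
  case base
  then show ?case by simp
next
  case (step n)
  have "real n * v ! n = (\<Sum>l<n. v ! n)" by simp
  also have "\<dots> \<le> value_upto v n"
    using v step.prems by (intro sum_mono) (auto simp: valuation_def sorted_wrt_iff_nth_less)
  finally have "avg_value v (Suc n) \<le> avg_value v n"
    using step.hyps assms(2) by (simp add: avg_value_def field_simps)
  then show ?case using step by simp
qed

section \<open>Uniform strategies\<close>

lemma num_bid_vector: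
  "num P (bid_vector s) = (\<Sum>l<length s. if P (fst (s ! l)) then snd (s ! l) else 0)"
proof -
  have "num P (bid_vector s) = (\<Sum>(b, q)\<leftarrow>s. if P b then q else 0)"
    by (induction s) (auto simp: bid_vector_def)
  also have "\<dots> = (\<Sum>l<length s. if P (fst (s ! l)) then snd (s ! l) else 0)"
    by (subst sum_list_sum_nth) (simp add: case_prod_beta atLeast0LessThan)
  finally show ?thesis .
qed

lemma quantity_upto_mono: "i \<le> j \<Longrightarrow> quantity_upto s i \<le> quantity_upto s j"
  unfolding quantity_upto_def by (intro sum_mono2) auto

lemma uniform_strategy_nth:
  assumes "uniform_strategy M k s"
  shows "\<And>l. l < k \<Longrightarrow> fst (s ! l) > 0" "\<And>l. l < k \<Longrightarrow> snd (s ! l) > 0"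
    "\<And>i l. i < l \<Longrightarrow> l < k \<Longrightarrow> fst (s ! l) < fst (s ! i)"
  using assms unfolding uniform_strategy_def
  by (force simp: case_prod_beta sorted_wrt_iff_nth_less)+

lemma quantity_upto_pos:
  assumes "uniform_strategy M k s" "l < k"
  shows "0 < quantity_upto s (Suc l)"
  using uniform_strategy_nth(2)[OF assms] by (simp add: quantity_upto_def)

lemma quantity_upto_le:
  assumes "uniform_strategy M k s" "l \<le> k"
  shows "quantity_upto s l \<le> M"
  using assms quantity_upto_mono[of l k s] by (auto simp: uniform_strategy_def)

lemma bid_vector_pos:
  assumes "uniform_strategy M k s" "b \<in> set (bid_vector s)"
  shows "b > 0"
  using assms by (force simp: uniform_strategy_def bid_vector_def)

text \<open>Bids decrease from block to block, so an upward closed condition selects a prefix of the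
  blocks. The condition is general because both thresholds \<open>r \<le> c\<close> and
  \<open>r < c\<close> occur.\<close>

lemma num_bid_vector_upclosed:
  assumes s: "uniform_strategy M k s" and P: "\<And>x y. P x \<Longrightarrow> x < y \<Longrightarrow> P y"
  obtains j where "j \<le> k" "\<And>l. l < k \<Longrightarrow> P (fst (s ! l)) \<longleftrightarrow> l < j"
    "num P (bid_vector s) = quantity_upto s j"
proof
  \<comment> \<open>The first block that fails \<open>P\<close>; the disjunct
    \<open>j \<ge> k\<close> yields \<open>k\<close> when no block fails.\<close>
  define j where "j = (LEAST j. j \<ge> k \<or> \<not> P (fst (s ! j)))"
  have jk: "j \<le> k" unfolding j_def by (rule Least_le) simp
  have j: "j \<ge> k \<or> \<not> P (fst (s ! j))" unfolding j_def by (rule LeastI[of _ k]) simp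
  show iff: "P (fst (s ! l)) \<longleftrightarrow> l < j" if "l < k" for l
  proof
    assume "l < j"
    then show "P (fst (s ! l))" using not_less_Least[of l] that by (auto simp: j_def)
  next
    assume l: "P (fst (s ! l))"
    show "l < j"
    proof (rule ccontr)
      assume "\<not> l < j"
      with j that have "\<not> P (fst (s ! j))" "j \<le> l" by auto
      with l P uniform_strategy_nth(3)[OF s, of j l] that show False
        by (cases "j = l") auto
    qed
  qed
  show "j \<le> k" by (rule jk)
  have "length s = k" using s by (simp add: uniform_strategy_def)
  then have "num P (bid_vector s) = (\<Sum>l<k. if l < j then snd (s ! l) else 0)"
    using iff by (auto simp: num_bid_vector intro!: sum.cong)
  also have "\<dots> = quantity_upto s j"
    unfolding quantity_upto_def using jk by (intro sum.mono_neutral_cong_right) auto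
  finally show "num P (bid_vector s) = quantity_upto s j" .
qed

text \<open>Keeps the sum in \<open>obtained_value\<close> within the list \<open>v\<close>.\<close>

lemma units_won_le_length:
  assumes "uniform_strategy M k s"
  shows "units_won K (bid_vector s) \<beta> \<le> M"
proof -
  have "units_won K (bid_vector s) \<beta> \<le> length (bid_vector s)"
    using units_won_le_num_ge_price[of "bid_vector s" K \<beta>] bid_vector_pos[OF assms]
      length_filter_le[of _ "bid_vector s"] by (meson le_trans less_imp_le)
  also have "\<dots> = quantity_upto s k"
    using num_bid_vector[of "\<lambda>_. True" s] assms by (simp add: quantity_upto_def uniform_strategy_def)
  finally show ?thesis using assms by (simp add: uniform_strategy_def)
qed

text \<open>The cumulative quantities \<open>Q\<close> determine the strategy; \<open>Q 0\<close> is its first quantity.\<close>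

definition strategy_of :: "nat \<Rightarrow> (nat \<Rightarrow> real) \<Rightarrow> (nat \<Rightarrow> nat) \<Rightarrow> strategy" where
  "strategy_of k b Q = map (\<lambda>l. (b l, case l of 0 \<Rightarrow> Q 0 | Suc i \<Rightarrow> Q (Suc i) - Q i)) [0..<k]"

lemma fst_strategy_of: "l < k \<Longrightarrow> fst (strategy_of k b Q ! l) = b l"
  by (simp add: strategy_of_def)

lemma quantity_upto_strategy_of:
  assumes "\<And>i. Suc i < k \<Longrightarrow> Q i < Q (Suc i)" "l < k"
  shows "quantity_upto (strategy_of k b Q) (Suc l) = Q l"
  using assms(2)
proof (induction l)
  case 0
  then show ?case by (simp add: quantity_upto_def strategy_of_def)
next
  case (Suc l)
  then have "quantity_upto (strategy_of k b Q) (Suc (Suc l)) = Q l + (Q (Suc l) - Q l)"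
    by (simp add: quantity_upto_def strategy_of_def)
  then show ?case using assms(1)[of l] Suc.prems by simp
qed

lemma uniform_strategy_of:
  assumes k: "k \<ge> 1"
    and Q: "0 < Q 0" "\<And>i. Suc i < k \<Longrightarrow> Q i < Q (Suc i)" "Q (k - 1) \<le> M"
    and b: "\<And>l. l < k \<Longrightarrow> b l > 0" "\<And>i l. i < l \<Longrightarrow> l < k \<Longrightarrow> b l < b i"
  shows "uniform_strategy M k (strategy_of k b Q)"
  unfolding uniform_strategy_def
proof (intro conjI)
  show "sorted_wrt (>) (map fst (strategy_of k b Q))"
    using b(2) by (auto simp: sorted_wrt_iff_nth_less strategy_of_def)
  show "\<forall>(c, q)\<in>set (strategy_of k b Q). 0 < c \<and> 0 < q"
    using b(1) Q(1,2) by (auto simp: strategy_of_def split: nat.splits)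
  show "quantity_upto (strategy_of k b Q) k \<le> M"
    using quantity_upto_strategy_of[of k Q "k - 1" b] Q(2,3) k by auto
qed (use k in \<open>simp_all add: strategy_of_def\<close>)

lemma num_ge_bid_vector:
  assumes "uniform_strategy M k s"
  shows "\<exists>j\<le>k. (\<forall>l<k. r \<le> fst (s ! l) \<longleftrightarrow> l < j) \<and>
    num (\<lambda>c. r \<le> c) (bid_vector s) = quantity_upto s j"
  by (rule num_bid_vector_upclosed[OF assms, of "\<lambda>c. r \<le> c"]) (simp, blast)

section \<open>The upper bound\<close>

lemma total_value_eq_sum_list: "total_value K v H s = (\<Sum>\<beta>\<leftarrow>H. obtained_value K v s \<beta>)"
  by (subst sum_list_sum_nth) (simp add: total_value_def atLeast0LessThan)

lemma units_won_le_K: "units_won K bs \<beta> \<le> K"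
  unfolding units_won_def by (rule le_trans[OF length_filter_le]) simp

text \<open>Bids are real numbers, but the total value depends only on the list of units won per
  round, whose entries are at most \<open>K\<close>.\<close>

lemma finite_total_values: "finite (total_value K v H ` B)"
proof (rule finite_subset)
  let ?L = "{xs. set xs \<subseteq> {..K} \<and> length xs = length H}"
  show "total_value K v H ` B \<subseteq> (\<lambda>xs. \<Sum>x\<leftarrow>xs. value_upto v x) ` ?L"
  proof (rule image_subsetI)
    fix s
    let ?xs = "map (units_won K (bid_vector s)) H"
    have "total_value K v H s = (\<Sum>x\<leftarrow>?xs. value_upto v x)"
      by (simp add: total_value_eq_sum_list obtained_value_def o_def)
    moreover have "?xs \<in> ?L" using units_won_le_K by auto
    ultimately show "total_value K v H s \<in> (\<lambda>xs. \<Sum>x\<leftarrow>xs. value_upto v x) ` ?L"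
      by (rule image_eqI)
  qed
  show "finite ((\<lambda>xs. \<Sum>x\<leftarrow>xs. value_upto v x) ` ?L)"
    by (intro finite_imageI finite_lists_length_eq) simp
qed

lemma total_value_le_best_value: "s \<in> B K v H \<Longrightarrow> total_value K v H s \<le> best_value B K v H"
  unfolding best_value_def by (intro Max_ge finite_total_values imageI)

lemma best_value_attained:
  assumes "B K v H \<noteq> {}"
  obtains s where "s \<in> B K v H" "best_value B K v H = total_value K v H s"
proof -
  have "best_value B K v H \<in> total_value K v H ` B K v H"
    unfolding best_value_def using assms by (intro Max_in finite_total_values) simp
  then show ?thesis using that by blast
qed

lemma obtained_value_nonneg:
  assumes "valuation v" "uniform_strategy (length v) k s"
  shows "0 \<le> obtained_value K v s \<beta>"
  unfolding obtained_value_def by (rule value_upto_nonneg[OF assms(1) units_won_le_length[OF assms(2)]])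

lemma total_value_nonneg:
  assumes "valuation v" "uniform_strategy (length v) k s"
  shows "0 \<le> total_value K v H s"
  unfolding total_value_def by (intro sum_nonneg obtained_value_nonneg[OF assms])

lemma payment_le_obtained_value:
  assumes "units_won K (bid_vector s) \<beta> > 0 \<Longrightarrow>
    price K (bid_vector s) \<beta> \<le> avg_value v (units_won K (bid_vector s) \<beta>)"
  shows "payment K s \<beta> \<le> obtained_value K v s \<beta>"
proof (cases "units_won K (bid_vector s) \<beta> = 0")
  case True
  then show ?thesis by (simp add: payment_def obtained_value_def)
next
  case False
  then show ?thesis
    using assms by (simp add: payment_def obtained_value_def value_upto_eq_avg mult.commute mult_left_mono)
qed

text \<open>\<open>Max\<close> is meaningful only on a nonempty set. Bidding the overall average on
  all units is feasible in every round: whenever \<open>x\<close> units are won, the price is at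
  most this average, which is at most the average of the first \<open>x\<close> values.\<close>

lemma roi_feasible_class_nonempty:
  assumes v: "valuation v" and m: "m \<ge> 1"
  shows "roi_feasible_class m K v H \<noteq> {}"
proof -
  let ?M = "length v"
  let ?s = "[(avg_value v ?M, ?M)]"
  have M: "?M > 0" using v by (simp add: valuation_def)
  have pos: "avg_value v ?M > 0" using avg_value_pos[OF v M] by simp
  have s: "uniform_strategy ?M 1 ?s"
    using M pos by (simp add: uniform_strategy_def quantity_upto_def)
  have "payment K ?s \<beta> \<le> obtained_value K v ?s \<beta>" for \<beta>
  proof (rule payment_le_obtained_value)
    let ?x = "units_won K (bid_vector ?s) \<beta>"
    assume x: "?x > 0"
    have "?x \<le> num (\<lambda>c. price K (bid_vector ?s) \<beta> \<le> c) (bid_vector ?s)"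
      by (rule units_won_le_num_ge_price) (use bid_vector_pos[OF s] in \<open>auto intro: less_imp_le\<close>)
    with x have "0 < num (\<lambda>c. price K (bid_vector ?s) \<beta> \<le> c) (bid_vector ?s)" by linarith
    then have "price K (bid_vector ?s) \<beta> \<le> avg_value v ?M"
      unfolding num_pos_iff by (auto simp: bid_vector_def)
    also have "\<dots> \<le> avg_value v ?x"
      using avg_value_antimono[OF v x] units_won_le_length[OF s] by simp
    finally show "price K (bid_vector ?s) \<beta> \<le> avg_value v ?x" .
  qed
  with s m have "?s \<in> roi_feasible_class m K v H"
    unfolding roi_feasible_class_def by blast
  then show ?thesis by blast
qed

section \<open>From an RoI feasible strategy to the levels of a safe one\<close>

text \<open>
  Equal averages \<open>w\<^sub>Q = w\<^sub>Q\<^sub>'\<close> would give equal bids, so only the largest quantity with a given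
  average is kept.
\<close>

lemma safe_strategy_with_levels:
  assumes v: "valuation v" and m: "m \<ge> 1" and T: "T \<subseteq> {1..length v}" "card T \<le> m" "T \<noteq> {}"
  obtains s where "s \<in> safe_class m K v H"
    "\<And>y. y \<in> T \<Longrightarrow> y \<le> num (\<lambda>c. avg_value v y \<le> c) (bid_vector s)"
proof -
  let ?w = "avg_value v"
  define T' where "T' = {q\<in>T. \<forall>y\<in>T. q < y \<longrightarrow> ?w y < ?w q}"
  have finT: "finite T" using T(1) finite_subset by blast
  have finT': "finite T'" using finT by (simp add: T'_def)
  have keep: "\<exists>q\<in>T'. y \<le> q \<and> ?w y \<le> ?w q" if "y \<in> T" for y
  proof -
    \<comment> \<open>The largest element of \<open>?C\<close> survives in \<open>T'\<close>: a
      larger \<open>z\<close> in \<open>T\<close> with at least its average would belong to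
      \<open>?C\<close> as well.\<close>
    let ?C = "{q\<in>T. y \<le> q \<and> ?w y \<le> ?w q}"
    have fin: "finite ?C" using finT by simp
    moreover have "y \<in> ?C" using that by simp
    ultimately have C: "Max ?C \<in> ?C" using Max_in[of ?C] by blast
    have "Max ?C \<in> T'"
      unfolding T'_def
    proof (intro CollectI conjI ballI impI)
      show "Max ?C \<in> T" using C by simp
      fix z assume z: "z \<in> T" "Max ?C < z"
      then have "z \<notin> ?C" using Max_ge[OF fin, of z] by linarith
      with z C show "?w z < ?w (Max ?C)" by auto
    qed
    with C show ?thesis by blast
  qed
  define Qs where "Qs = sorted_list_of_set T'"
  define k where "k = length Qs"
  have set_Qs: "set Qs = T'" by (simp add: Qs_def finT')
  have Qs_less: "Qs ! i < Qs ! j" if "i < j" "j < k" for i j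
    using that strict_sorted_list_of_set[of T'] unfolding Qs_def k_def
    by (simp add: sorted_wrt_iff_nth_less)
  have in_T': "Qs ! i \<in> T'" if "i < k" for i
    using that set_Qs nth_mem k_def by blast
  have in_T: "Qs ! i \<in> {1..length v}" if "i < k" for i
    using in_T'[OF that] T(1) by (auto simp: T'_def)
  have kT: "k = card T'" by (simp add: k_def Qs_def)
  have "k \<noteq> 0" using T(3) keep finT' kT by auto
  then have k1: "k \<ge> 1" by simp
  have "card T' \<le> card T" by (rule card_mono[OF finT]) (auto simp: T'_def)
  then have km: "k \<le> m" using T(2) kT by simp
  define s where "s = strategy_of k (\<lambda>l. ?w (Qs ! l)) (\<lambda>l. Qs ! l)"
  have s: "uniform_strategy (length v) k s"
    unfolding s_def
  proof (rule uniform_strategy_of[OF k1])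
    show "?w (Qs ! l) > 0" if "l < k" for l
      using avg_value_pos[OF v] in_T[OF that] by simp
    show "?w (Qs ! l) < ?w (Qs ! i)" if "i < l" "l < k" for i l
      using in_T'[of i] in_T'[of l] Qs_less[OF that] that by (simp add: T'_def)
  qed (use in_T[of 0] in_T[of "k - 1"] k1 Qs_less in auto)
  have bid: "fst (s ! l) = ?w (Qs ! l)" if "l < k" for l
    using that by (simp add: s_def fst_strategy_of)
  have quantity: "quantity_upto s (Suc l) = Qs ! l" if "l < k" for l
    unfolding s_def using that Qs_less by (intro quantity_upto_strategy_of) auto
  show ?thesis
  proof
    show "s \<in> safe_class m K v H"
      unfolding safe_class_def using s km bid quantity by auto
    fix y assume "y \<in> T"
    then obtain q where q: "q \<in> T'" "y \<le> q" "?w y \<le> ?w q" using keep by blast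
    then obtain i where i: "i < k" "q = Qs ! i"
      using set_Qs k_def by (metis in_set_conv_nth)
    obtain j where j: "j \<le> k" "\<And>l. l < k \<Longrightarrow> ?w y \<le> fst (s ! l) \<longleftrightarrow> l < j"
      "num (\<lambda>c. ?w y \<le> c) (bid_vector s) = quantity_upto s j"
      using num_ge_bid_vector[OF s] by metis
    have "Suc i \<le> j" using j(2)[OF i(1)] bid[OF i(1)] q(3) i(2) by simp
    then have "q \<le> quantity_upto s j"
      using quantity_upto_mono[of "Suc i" j s] quantity[OF i(1)] i(2) by simp
    then show "y \<le> num (\<lambda>c. ?w y \<le> c) (bid_vector s)" using q(2) j(3) by simp
  qed
qed

text \<open>
  Every round is won at one of at most \<open>2k\<close> quantities: if the price is not one of the \<open>k\<close> bids,
  the bidder wins a full prefix of the blocks; otherwise the largest quantity won at that price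
  serves, because it is worth at least the price on average.
\<close>

lemma roi_feasible_levels:
  assumes v: "valuation v" and K: "K \<ge> 1" and s: "uniform_strategy (length v) k s"
    and roi: "\<And>\<beta>. \<beta> \<in> set H \<Longrightarrow> payment K s \<beta> \<le> obtained_value K v s \<beta>"
  obtains S where "S \<subseteq> {1..length v}" "card S \<le> 2 * k"
    "\<And>\<beta>. \<beta> \<in> set H \<Longrightarrow> units_won K (bid_vector s) \<beta> > 0 \<Longrightarrow>
       \<exists>y\<in>S. units_won K (bid_vector s) \<beta> \<le> y \<and>
         units_won K (bid_vector s) \<beta> + num (\<lambda>c. avg_value v y < c) \<beta> \<le> K"
proof -
  let ?w = "avg_value v" and ?x = "units_won K (bid_vector s)" and ?p = "price K (bid_vector s)"
  define G where "G b = {\<beta>\<in>set H. ?x \<beta> > 0 \<and> ?p \<beta> = b}" for b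
  define B where "B = {b\<in>fst ` set s. G b \<noteq> {}}"
  define S1 where "S1 = (\<lambda>b. Max (?x ` G b)) ` B"
  define S2 where "S2 = (\<lambda>l. quantity_upto s (Suc l)) ` {..<k}"
  have finG: "finite (G b)" for b by (simp add: G_def)
  have finB: "finite B" by (simp add: B_def)
  have price_le_avg: "?p \<beta> \<le> ?w (?x \<beta>)" if "\<beta> \<in> set H" "?x \<beta> > 0" for \<beta>
    using roi[OF that(1)] that(2)
    by (simp add: payment_def obtained_value_def value_upto_eq_avg mult.commute)
  have max_G: "\<exists>\<gamma>\<in>G b. Max (?x ` G b) = ?x \<gamma>" if "G b \<noteq> {}" for b
  proof -
    have "Max (?x ` G b) \<in> ?x ` G b"
      by (rule Max_in) (use finG that in simp_all)
    then show ?thesis by (rule imageE) (rule bexI)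
  qed
  show ?thesis
  proof
    have "S1 \<subseteq> {1..length v}"
    proof
      fix y assume "y \<in> S1"
      then obtain b where "G b \<noteq> {}" "y = Max (?x ` G b)" by (auto simp: S1_def B_def)
      with max_G obtain \<gamma> where "\<gamma> \<in> G b" "y = ?x \<gamma>" by metis
      then show "y \<in> {1..length v}" using units_won_le_length[OF s, of K \<gamma>] by (simp add: G_def)
    qed
    moreover have "S2 \<subseteq> {1..length v}"
    proof
      fix y assume "y \<in> S2"
      then obtain l where "l < k" "y = quantity_upto s (Suc l)" by (auto simp: S2_def)
      then show "y \<in> {1..length v}"
        using quantity_upto_pos[OF s, of l] quantity_upto_le[OF s, of "Suc l"] by simp
    qed
    ultimately show "S1 \<union> S2 \<subseteq> {1..length v}" by blast
    have "card S1 \<le> card B" unfolding S1_def by (rule card_image_le[OF finB])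
    also have "\<dots> \<le> card (fst ` set s)" by (rule card_mono) (auto simp: B_def)
    also have "\<dots> \<le> card (set s)" by (rule card_image_le) simp
    also have "\<dots> \<le> k" using s card_length[of s] by (simp add: uniform_strategy_def)
    finally have "card S1 \<le> k" .
    moreover have "card S2 \<le> k" unfolding S2_def using card_image_le[of "{..<k}"] by simp
    ultimately show "card (S1 \<union> S2) \<le> 2 * k" using card_Un_le[of S1 S2] by linarith
  next
    fix \<beta> assume \<beta>: "\<beta> \<in> set H" and x: "?x \<beta> > 0"
    \<comment> \<open>Any level whose average is at least the price meets the demand condition,
      since competing bids above that average also exceed the price.\<close>
    have demand: "?x \<beta> + num (\<lambda>c. ?w y < c) \<beta> \<le> K" if "?p \<beta> \<le> ?w y" for y
    proof -
      have "num (\<lambda>c. ?w y < c) \<beta> \<le> num (\<lambda>c. ?p \<beta> < c) \<beta>"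
        by (rule num_mono) (use that in simp)
      then show ?thesis using units_won_add_num_gt_price[OF K, of "bid_vector s" \<beta>] by linarith
    qed
    show "\<exists>y\<in>S1 \<union> S2. ?x \<beta> \<le> y \<and> ?x \<beta> + num (\<lambda>c. ?w y < c) \<beta> \<le> K"
    proof (cases "?p \<beta> \<in> fst ` set s")
      case True
      let ?G = "G (?p \<beta>)"
      have in_G: "\<beta> \<in> ?G" using \<beta> x by (simp add: G_def)
      then have in_S: "Max (?x ` ?G) \<in> S1" using True by (auto simp: S1_def B_def)
      \<comment> \<open>Round \<open>\<gamma>\<close> attains the maximum and has the same price as
        \<open>\<beta>\<close>, so its RoI constraint bounds the price of \<open>\<beta>\<close> by
        the average at the larger quantity.\<close>
      obtain \<gamma> where \<gamma>: "\<gamma> \<in> ?G" "Max (?x ` ?G) = ?x \<gamma>" using max_G in_G by (metis empty_iff)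
      then have "?p \<beta> \<le> ?w (Max (?x ` ?G))" using price_le_avg[of \<gamma>] by (simp add: G_def)
      moreover have "?x \<beta> \<le> Max (?x ` ?G)" using in_G finG by simp
      ultimately show ?thesis using in_S demand by blast
    next
      case False
      obtain j where j: "j \<le> k" "\<And>l. l < k \<Longrightarrow> ?p \<beta> \<le> fst (s ! l) \<longleftrightarrow> l < j"
        "num (\<lambda>c. ?p \<beta> \<le> c) (bid_vector s) = quantity_upto s j"
        using num_ge_bid_vector[OF s] by metis
      \<comment> \<open>No own bid equals the price, so counting own bids weakly or strictly above
        it gives the same number, which pins down the units won.\<close>
      have "filter (\<lambda>c. ?p \<beta> \<le> c) (bid_vector s) = filter (\<lambda>c. ?p \<beta> < c) (bid_vector s)"
        by (rule filter_cong) (use False in \<open>force simp: bid_vector_def image_iff\<close>)+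
      then have "quantity_upto s j \<le> ?x \<beta>"
        using num_gt_price_le_units_won[OF K, of "bid_vector s" \<beta>] j(3) by simp
      moreover have "?x \<beta> \<le> quantity_upto s j"
        using units_won_le_num_ge_price[of "bid_vector s" K \<beta>] bid_vector_pos[OF s] j(3)
        by (simp add: less_imp_le)
      ultimately have eq: "?x \<beta> = quantity_upto s j" by simp
      with x have "j \<noteq> 0" by (cases j) (simp_all add: quantity_upto_def)
      with j(1) obtain l where "j = Suc l" "l < k" by (cases j) auto
      then have "?x \<beta> \<in> S2" using eq by (auto simp: S2_def)
      then show ?thesis using demand price_le_avg[OF \<beta> x] by blast
    qed
  qed
qed

text \<open>The \<open>m\<close> largest of \<open>n\<close> numbers have at least the average of
  all. Induction on \<open>n\<close> discards a minimal element, which is at most the mean of the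
  others.\<close>

lemma heavy_subset_card:
  fixes f :: "'a \<Rightarrow> real"
  assumes "1 \<le> m" "m \<le> n" "finite S" "card S = n"
  shows "\<exists>T\<subseteq>S. card T = m \<and> real m * sum f S \<le> real n * sum f T"
  using assms(2-4)
proof (induction n arbitrary: S rule: dec_induct)
  case base
  then show ?case by (intro exI[of _ S]) simp
next
  case (step n)
  have ne: "S \<noteq> {}" using step.prems by auto
  define a where "a = arg_min_on f S"
  have a: "a \<in> S" "\<And>y. y \<in> S \<Longrightarrow> f a \<le> f y"
    unfolding a_def using step.prems(1) ne
    by (rule arg_min_if_finite(1), rule arg_min_least)
  let ?S = "S - {a}"
  have card: "card ?S = n" "finite ?S" using a(1) step.prems by auto
  have sum: "sum f S = f a + sum f ?S" using a(1) step.prems(1) by (simp add: sum.remove)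
  obtain T where T: "T \<subseteq> ?S" "card T = m" "real m * sum f ?S \<le> real n * sum f T"
    using step.IH[OF card(2,1)] by auto
  have "real n * f a \<le> sum f ?S"
    using sum_bounded_below[of ?S "f a" f] a(2) card by simp
  then have "real m * (real n * f a) \<le> real m * sum f ?S"
    by (rule mult_left_mono) simp
  then have "real n * (real m * sum f S) \<le> (real n + 1) * (real m * sum f ?S)"
    unfolding sum by (simp add: algebra_simps)
  also have "\<dots> \<le> (real n + 1) * (real n * sum f T)"
    by (rule mult_left_mono[OF T(3)]) simp
  finally have "real n * (real m * sum f S) \<le> real n * (real (Suc n) * sum f T)"
    by (simp add: algebra_simps)
  moreover have "real n > 0" using assms(1) step.hyps(1) by simp
  ultimately have "real m * sum f S \<le> real (Suc n) * sum f T"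
    using mult_le_cancel_left_pos by blast
  moreover have "T \<subseteq> S" using T(1) by auto
  ultimately show ?case using T(2) by (intro exI[of _ T]) simp
qed

text \<open>The number of levels is only bounded by \<open>n\<close>, as blocks may be fewer and
  quantities may coincide; nonnegativity of \<open>f\<close> permits the factor \<open>n\<close> in
  place of \<open>card S\<close>.\<close>

lemma heavy_subset:
  fixes f :: "'a \<Rightarrow> real"
  assumes "finite S" "card S \<le> n" "1 \<le> m" "m \<le> n" and f: "\<And>y. y \<in> S \<Longrightarrow> f y \<ge> 0"
  obtains T where "T \<subseteq> S" "card T \<le> m" "real m * sum f S \<le> real n * sum f T"
proof (cases "card S \<le> m")
  case True
  have "real m * sum f S \<le> real n * sum f S"
    using assms by (intro mult_right_mono sum_nonneg) auto
  with True show ?thesis using that by blast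
next
  case False
  then obtain T where T: "T \<subseteq> S" "card T = m" "real m * sum f S \<le> real (card S) * sum f T"
    using heavy_subset_card[of m "card S" S f] assms by auto
  have "real (card S) * sum f T \<le> real n * sum f T"
    using assms T(1) by (intro mult_right_mono sum_nonneg) auto
  with T show ?thesis using that[of T] by linarith
qed

text \<open>Each round with a win is charged to one level \<open>Y t\<close>. The heaviest
  \<open>m\<close> levels carry the required share of the value, and a safe strategy containing them
  wins at least as many units in every round charged to them.\<close>

lemma roi_feasible_le_safe:
  assumes m: "1 \<le> m" "m \<le> m'" and inst: "auction_instance K v H"
    and s: "s \<in> roi_feasible_class m' K v H"
  obtains s' where "s' \<in> safe_class m K v H"
    "real m * total_value K v H s \<le> real (2 * m') * total_value K v H s'"
proof -
  let ?w = "avg_value v" and ?x = "\<lambda>t. units_won K (bid_vector s) (H ! t)"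
  have v: "valuation v" and K: "K \<ge> 1" using inst by (auto simp: auction_instance_def)
  have M: "length v \<ge> 1" using v by (cases v) (auto simp: valuation_def)
  obtain k where k: "k \<le> m'" "uniform_strategy (length v) k s"
    "\<And>\<beta>. \<beta> \<in> set H \<Longrightarrow> payment K s \<beta> \<le> obtained_value K v s \<beta>"
    using s unfolding roi_feasible_class_def by blast
  obtain S where S: "S \<subseteq> {1..length v}" "card S \<le> 2 * k"
    and level: "\<And>\<beta>. \<beta> \<in> set H \<Longrightarrow> units_won K (bid_vector s) \<beta> > 0 \<Longrightarrow>
       \<exists>y\<in>S. units_won K (bid_vector s) \<beta> \<le> y \<and>
         units_won K (bid_vector s) \<beta> + num (\<lambda>c. ?w y < c) \<beta> \<le> K"
    using roi_feasible_levels[OF v K k(2,3)] by blast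
  have finS: "finite S" using S(1) finite_subset by blast
  define R where "R = {t. t < length H \<and> ?x t > 0}"
  have finR: "finite R" by (simp add: R_def)
  have "\<forall>t\<in>R. \<exists>y\<in>S. ?x t \<le> y \<and> ?x t + num (\<lambda>c. ?w y < c) (H ! t) \<le> K"
    using level by (simp add: R_def)
  then obtain Y where Y: "\<And>t. t \<in> R \<Longrightarrow> Y t \<in> S"
    "\<And>t. t \<in> R \<Longrightarrow> ?x t \<le> Y t \<and> ?x t + num (\<lambda>c. ?w (Y t) < c) (H ! t) \<le> K"
    by metis
  let ?f = "\<lambda>y. \<Sum>t | t \<in> R \<and> Y t = y. value_upto v (?x t)"
  have "total_value K v H s = (\<Sum>t\<in>R. value_upto v (?x t))"
    unfolding total_value_def obtained_value_def
    by (rule sum.mono_neutral_right) (auto simp: R_def)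
  also have "\<dots> = sum ?f S"
    using Y(1) by (subst sum.group[OF finR finS]) auto
  finally have total: "total_value K v H s = sum ?f S" .
  have nonneg: "value_upto v (?x t) \<ge> 0" for t
    by (rule value_upto_nonneg[OF v units_won_le_length[OF k(2)]])
  obtain T where T: "T \<subseteq> S" "card T \<le> m" "real m * sum ?f S \<le> real (2 * m') * sum ?f T"
  proof (rule heavy_subset[of S "2 * m'" m ?f])
    show "?f y \<ge> 0" for y by (rule sum_nonneg) (rule nonneg)
  qed (use finS S(2) k(1) m in auto)
  \<comment> \<open>\<open>T\<close> may be empty, for instance if nothing is ever won, but a
    strategy needs a block; level 1 serves as a dummy.\<close>
  define T' where "T' = (if T = {} then {1} else T)"
  have "T' \<subseteq> {1..length v}" "card T' \<le> m" "T' \<noteq> {}"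
    using T S(1) M m(1) by (auto simp: T'_def)
  then obtain s' where s': "s' \<in> safe_class m K v H"
    and levels: "\<And>y. y \<in> T' \<Longrightarrow> y \<le> num (\<lambda>c. ?w y \<le> c) (bid_vector s')"
    using safe_strategy_with_levels[OF v m(1)] by metis
  obtain k' where k': "uniform_strategy (length v) k' s'"
    using s' by (auto simp: safe_class_def)
  have finT: "finite T" using T(1) finS finite_subset by blast
  have "sum ?f T = (\<Sum>t | t \<in> R \<and> Y t \<in> T. value_upto v (?x t))"
  proof -
    have "(\<Sum>t | t \<in> R \<and> Y t \<in> T. value_upto v (?x t)) =
        (\<Sum>y\<in>T. \<Sum>t | t \<in> {t \<in> R. Y t \<in> T} \<and> Y t = y. value_upto v (?x t))"
      using finR finT by (subst sum.group) auto
    also have "\<dots> = sum ?f T" by (intro sum.cong) auto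
    finally show ?thesis by simp
  qed
  also have "\<dots> \<le> (\<Sum>t | t \<in> R \<and> Y t \<in> T. obtained_value K v s' (H ! t))"
    unfolding obtained_value_def
  proof (rule sum_mono)
    fix t assume "t \<in> {t. t \<in> R \<and> Y t \<in> T}"
    then have t: "t \<in> R" "Y t \<in> T'" by (auto simp: T'_def)
    have "?x t \<le> units_won K (bid_vector s') (H ! t)"
      using levels[OF t(2)] Y(2)[OF t(1)] by (intro units_won_ge[of _ "?w (Y t)"]) auto
    then show "value_upto v (?x t) \<le> value_upto v (units_won K (bid_vector s') (H ! t))"
      by (rule value_upto_mono[OF v]) (rule units_won_le_length[OF k'])
  qed
  also have "\<dots> \<le> total_value K v H s'"
    unfolding total_value_def
    by (rule sum_mono2) (auto simp: R_def intro: obtained_value_nonneg[OF v k'])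
  finally have "real (2 * m') * sum ?f T \<le> real (2 * m') * total_value K v H s'"
    by (rule mult_left_mono) simp
  with T(3) have "real m * total_value K v H s \<le> real (2 * m') * total_value K v H s'"
    unfolding total by (rule order_trans)
  with s' show ?thesis by (rule that)
qed

section \<open>The bound on the worst-case ratio\<close>

lemma best_roi_feasible_le:
  assumes "1 \<le> m" "m \<le> m'" "auction_instance K v H"
  shows "real m * best_value (roi_feasible_class m') K v H \<le>
    2 * real m' * best_value (safe_class m) K v H"
proof -
  have "roi_feasible_class m' K v H \<noteq> {}"
    using assms by (intro roi_feasible_class_nonempty) (auto simp: auction_instance_def)
  then obtain s where s: "s \<in> roi_feasible_class m' K v H"
    "best_value (roi_feasible_class m') K v H = total_value K v H s"
    by (rule best_value_attained)
  obtain s' where s': "s' \<in> safe_class m K v H"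
    "real m * total_value K v H s \<le> real (2 * m') * total_value K v H s'"
    using roi_feasible_le_safe[OF assms s(1)] .
  note s'(2)
  also have "real (2 * m') * total_value K v H s' \<le>
      2 * real m' * best_value (safe_class m) K v H"
    using total_value_le_best_value[of s' "safe_class m" K v H] s'(1) by (simp add: mult_left_mono)
  finally show ?thesis by (simp add: s(2))
qed

lemma safe_class_nonempty:
  assumes "valuation v" "m \<ge> 1"
  shows "safe_class m K v H \<noteq> {}"
proof (rule safe_strategy_with_levels[OF assms])
  show "{1} \<subseteq> {1..length v}" using assms(1) by (cases v) (auto simp: valuation_def)
  show "card {1::nat} \<le> m" using assms(2) by simp
  show "safe_class m K v H \<noteq> {}" if "s \<in> safe_class m K v H" for s using that by blast
qed simp

lemma best_safe_nonneg:
  assumes "valuation v" "m \<ge> 1"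
  shows "0 \<le> best_value (safe_class m) K v H"
proof -
  obtain s where "s \<in> safe_class m K v H"
    "best_value (safe_class m) K v H = total_value K v H s"
    using best_value_attained safe_class_nonempty[OF assms] by metis
  then show ?thesis using total_value_nonneg[OF assms(1)] by (auto simp: safe_class_def)
qed

lemma worst_case_ratio_le:
  assumes m: "1 \<le> m" "m \<le> m'"
  shows "worst_case_ratio (roi_feasible_class m') (safe_class m) \<le> ereal (2 * real m' / real m)"
  unfolding worst_case_ratio_def
proof (rule Sup_least, clarify)
  fix K v H assume inst: "auction_instance K v H"
  let ?A = "best_value (roi_feasible_class m') K v H" and ?B = "best_value (safe_class m) K v H"
  have "?B \<ge> 0" using best_safe_nonneg m inst by (auto simp: auction_instance_def)
  \<comment> \<open>If \<open>?B = 0\<close>, the quotient is 0 because division by zero yields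
    0.\<close>
  then have "?A / ?B \<le> 2 * real m' / real m"
    using best_roi_feasible_le[OF m inst] m(1)
    by (cases "?B = 0") (auto simp: field_simps)
  then show "ereal (value_ratio (roi_feasible_class m') (safe_class m) K v H)
      \<le> ereal (2 * real m' / real m)"
    by (simp add: value_ratio_def)
qed

section \<open>A hard instance\<close>

text \<open>With all values 1 every average would be 1, and a single safe level would serve all
  groups. The extra 1 on the first unit separates the averages and adds only 1 to each obtained
  value.\<close>

definition hard_valuation :: "nat \<Rightarrow> real list" where
  "hard_valuation D = 2 # replicate (D - 1) 1"

lemma length_hard_valuation: "D \<ge> 1 \<Longrightarrow> length (hard_valuation D) = D"
  by (simp add: hard_valuation_def)

lemma valuation_hard_valuation: "valuation (hard_valuation D)"
  by (auto simp: valuation_def hard_valuation_def sorted_wrt_iff_nth_less nth_Cons split: nat.splits)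

lemma value_upto_hard_valuation:
  assumes "1 \<le> j" "j \<le> D"
  shows "value_upto (hard_valuation D) j = real j + 1"
  using assms
proof (induction j rule: dec_induct)
  case base
  then show ?case by (simp add: hard_valuation_def)
next
  case (step i)
  then have "hard_valuation D ! i = 1" by (simp add: hard_valuation_def nth_Cons')
  with step show ?case by simp
qed

lemma avg_value_hard_valuation:
  assumes "1 \<le> j" "j \<le> D"
  shows "avg_value (hard_valuation D) j = 1 + 1 / real j"
  using value_upto_hard_valuation[OF assms] assms(1) by (simp add: avg_value_def field_simps)

text \<open>
  Bids below \<open>1 + 1 / y\<close> win nothing.  For odd \<open>g\<close> the bidder cannot outbid the \<open>K - y\<close> bids of 3, so
  surplus bids at \<open>1 + 1 / y\<close> lose and set the price; for even \<open>g\<close> all bids from \<open>1 + 1 / y\<close> on win.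
\<close>

definition hard_bids :: "nat \<Rightarrow> nat \<Rightarrow> nat \<Rightarrow> real list" where
  "hard_bids K g y =
     (if odd g then replicate (K - y) 3 @ replicate y (1 + 1 / real y)
      else replicate K (1 + 1 / real y))"

lemma
  assumes "1 \<le> y" "y \<le> K"
  shows num_ge_hard_bids: "num (\<lambda>c. 1 + 1 / real y \<le> c) (hard_bids K g y) = K"
    and num_gt_hard_bids:
      "num (\<lambda>c. 1 + 1 / real y < c) (hard_bids K g y) = (if odd g then K - y else 0)"
proof -
  have "1 / real y \<le> 1" using assms by simp
  then show "num (\<lambda>c. 1 + 1 / real y \<le> c) (hard_bids K g y) = K"
    "num (\<lambda>c. 1 + 1 / real y < c) (hard_bids K g y) = (if odd g then K - y else 0)"
    using assms(2) by (auto simp: hard_bids_def)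
qed

text \<open>The multiplicities balance the groups: winning \<open>N ^ g\<close> units throughout
  group \<open>g\<close> is worth about \<open>N ^ n\<close> for every \<open>g\<close>. The supply
  exceeds the demand \<open>N ^ n\<close> by one, so that even in group \<open>n\<close>, when all
  own bids win, a competing bid sets the price.\<close>

definition hard_history :: "nat \<Rightarrow> nat \<Rightarrow> real list list" where
  "hard_history N n =
     concat (map (\<lambda>g. replicate (N ^ (n - g)) (hard_bids (N ^ n + 1) g (N ^ g))) [1..<Suc n])"

lemma set_hard_history:
  "\<beta> \<in> set (hard_history N n) \<Longrightarrow> \<exists>g\<in>{1..n}. \<beta> = hard_bids (N ^ n + 1) g (N ^ g)"
  by (force simp: hard_history_def)

lemma total_value_hard_history:
  "total_value K v (hard_history N n) s =
     (\<Sum>g=1..n. real (N ^ (n - g)) * obtained_value K v s (hard_bids (N ^ n + 1) g (N ^ g)))"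
proof -
  have "(\<Sum>x\<leftarrow>concat (map (\<lambda>g. replicate (a g) (h g)) xs). f x) = (\<Sum>g\<leftarrow>xs. real (a g) * f (h g))"
    for a :: "nat \<Rightarrow> nat" and h :: "nat \<Rightarrow> real list" and f :: "real list \<Rightarrow> real" and xs
    by (induction xs) (simp_all add: sum_list_replicate)
  then show ?thesis
    unfolding total_value_eq_sum_list hard_history_def
    by (simp add: interv_sum_list_conv_sum_set_nat atLeastLessThanSuc_atLeastAtMost del: upt_Suc)
qed

lemma auction_instance_hard:
  assumes "N \<ge> 2" "n \<ge> 1"
  shows "auction_instance (N ^ n + 1) (hard_valuation (N ^ n)) (hard_history N n)"
proof -
  have "hard_history N n \<noteq> []"
    using assms by (auto simp: hard_history_def intro!: bexI[of _ n])
  moreover have "\<forall>\<beta>\<in>set (hard_history N n). \<forall>c\<in>set \<beta>. c \<ge> 0"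
    using set_hard_history by (fastforce simp: hard_bids_def split: if_splits)
  ultimately show ?thesis
    using valuation_hard_valuation by (simp add: auction_instance_def bid_history_def)
qed

text \<open>Only bids of at least \<open>1 + 1 / y\<close> can win, and a safe block ending at
  \<open>q\<close> bids \<open>1 + 1 / q\<close>, so only blocks with \<open>q \<le> y\<close>
  count. The last of them bounds the value; summing over all of them is cruder but lets each level
  be estimated separately.\<close>

lemma obtained_value_safe_hard_bids:
  assumes s: "uniform_strategy D k s" and D: "D \<ge> 1"
    and bids: "\<And>l. l < k \<Longrightarrow> fst (s ! l) = avg_value (hard_valuation D) (quantity_upto s (Suc l))"
    and y: "1 \<le> y" "y \<le> K"
  shows "obtained_value K (hard_valuation D) s (hard_bids K g y) \<le>
    (\<Sum>l<k. if quantity_upto s (Suc l) \<le> y then real (quantity_upto s (Suc l)) + 1 else 0)"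
    (is "_ \<le> (\<Sum>l<k. ?f l)")
proof -
  let ?v = "hard_valuation D" and ?u = "units_won K (bid_vector s) (hard_bids K g y)"
  obtain j where j: "j \<le> k" "\<forall>l<k. 1 + 1 / real y \<le> fst (s ! l) \<longleftrightarrow> l < j"
    "num (\<lambda>c. 1 + 1 / real y \<le> c) (bid_vector s) = quantity_upto s j"
    using num_ge_bid_vector[OF s] by metis
  have "?u \<le> quantity_upto s j"
    using units_won_le[of K "1 + 1 / real y" "hard_bids K g y" "bid_vector s"]
      num_ge_hard_bids[OF y, of g] j(3) by simp
  then have le: "obtained_value K ?v s (hard_bids K g y) \<le> value_upto ?v (quantity_upto s j)"
    unfolding obtained_value_def
    using quantity_upto_le[OF s j(1)] length_hard_valuation[OF D]
    by (intro value_upto_mono valuation_hard_valuation) simp_all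
  show ?thesis
  proof (cases j)
    case 0
    then have "value_upto ?v (quantity_upto s j) = 0" by (simp add: quantity_upto_def)
    moreover have "0 \<le> (\<Sum>l<k. ?f l)" by (rule sum_nonneg) simp
    ultimately show ?thesis using le by linarith
  next
    case (Suc l)
    then have l: "l < k" using j(1) by simp
    let ?q = "quantity_upto s (Suc l)"
    have q: "1 \<le> ?q" "?q \<le> D"
      using quantity_upto_pos[OF s l] quantity_upto_le[OF s, of "Suc l"] l by simp_all
    have "1 + 1 / real y \<le> fst (s ! l)" using j(2) l Suc by blast
    then have "1 + 1 / real y \<le> 1 + 1 / real ?q"
      using bids[OF l] avg_value_hard_valuation[OF q] by simp
    then have "?q \<le> y" using q(1) y(1) by (simp add: field_simps)
    then have "value_upto ?v (quantity_upto s j) = ?f l"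
      using Suc value_upto_hard_valuation[OF q] by simp
    also have "\<dots> \<le> (\<Sum>l<k. ?f l)" using l by (intro member_le_sum) auto
    finally show ?thesis using le by linarith
  qed
qed

text \<open>
  A quantity \<open>q\<close> with \<open>N ^ (h - 1) < q \<le> N ^ h\<close> contributes \<open>q + 1\<close> to all groups \<open>g \<ge> h\<close>; the
  weights \<open>N ^ (n - g)\<close> make group \<open>h\<close> dominate.
\<close>

lemma level_contribution:
  fixes N q n :: nat
  assumes N: "N \<ge> 2" and q: "q \<ge> 1"
  shows "(real N - 1) * (\<Sum>g=1..n. real (N ^ (n - g)) * (if q \<le> N ^ g then real q + 1 else 0))
    \<le> real (N ^ n) * (real N + 1)"
proof -
  define S where "S n = (\<Sum>g=1..n. real (N ^ (n - g)) * (if q \<le> N ^ g then real q + 1 else 0))" for n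
  have S_Suc: "S (Suc n) = real N * S n + (if q \<le> N ^ Suc n then real q + 1 else 0)" for n
  proof -
    have "(\<Sum>g=1..n. real (N ^ (Suc n - g)) * (if q \<le> N ^ g then real q + 1 else 0)) = real N * S n"
      unfolding S_def sum_distrib_left
      by (rule sum.cong) (auto simp: Suc_diff_le)
    then show ?thesis by (simp add: S_def)
  qed
  \<comment> \<open>The term \<open>real q + 1\<close> strengthens the induction and pays for the
    next summand: \<open>(N - 1) * (N * S n + q + 1) + (q + 1) = N * ((N - 1) * S n + q +
    1)\<close>.\<close>
  have "if q \<le> N ^ n then (real N - 1) * S n + (real q + 1) \<le> real (N ^ n) * (real N + 1) else S n = 0"
  proof (induction n)
    case 0
    then show ?case using q N by (simp add: S_def)
  next
    case (Suc n)
    consider "q \<le> N ^ n" | "N ^ n < q" "q \<le> N ^ Suc n" | "N ^ Suc n < q" by linarith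
    then show ?case
    proof cases
      case 1
      then have q': "q \<le> N ^ Suc n"
        using N by (metis le_trans le_add2 mult_2 mult_le_mono1 power_Suc)
      have "real N * ((real N - 1) * S n + (real q + 1)) \<le> real N * (real (N ^ n) * (real N + 1))"
        using Suc.IH 1 by (intro mult_left_mono) auto
      then show ?thesis using q' by (simp add: S_Suc algebra_simps)
    next
      \<comment> \<open>Here \<open>S n = 0\<close>, so the left side is \<open>N * (q + 1)\<close>,
        and both \<open>q\<close> and \<open>N\<close> are at most \<open>N ^ Suc n\<close>.\<close>
      case 2
      have "N \<le> N ^ Suc n" using N by simp
      then have "real N \<le> real (N ^ Suc n)" by (rule of_nat_mono)
      moreover have "real N * real q \<le> real N * real (N ^ Suc n)"
        using 2 by (intro mult_left_mono of_nat_mono) auto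
      ultimately show ?thesis using 2 Suc.IH by (simp add: S_Suc algebra_simps)
    next
      case 3
      have "N ^ n \<le> N ^ Suc n" using N by simp
      with 3 have "\<not> q \<le> N ^ n" "\<not> q \<le> N ^ Suc n" by linarith+
      then show ?thesis using Suc.IH by (simp add: S_Suc)
    qed
  qed
  then have "(real N - 1) * S n \<le> real (N ^ n) * (real N + 1)"
    by (auto split: if_splits)
  then show ?thesis by (simp add: S_def)
qed

text \<open>Each of at most \<open>m\<close> levels earns at most
  \<open>N ^ n * (N + 1) / (N - 1)\<close> over the whole history.\<close>

lemma best_safe_hard_le:
  assumes m: "m \<ge> 1" and N: "N \<ge> 2"
  shows "(real N - 1) *
      best_value (safe_class m) (N ^ n + 1) (hard_valuation (N ^ n)) (hard_history N n)
    \<le> real m * (real (N ^ n) * (real N + 1))"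
proof -
  let ?D = "N ^ n" and ?K = "N ^ n + 1" and ?H = "hard_history N n"
  let ?v = "hard_valuation ?D"
  have D: "?D \<ge> 1" using N by simp
  obtain s where s: "s \<in> safe_class m ?K ?v ?H"
    and best: "best_value (safe_class m) ?K ?v ?H = total_value ?K ?v ?H s"
    using best_value_attained safe_class_nonempty[OF valuation_hard_valuation m] by metis
  then obtain k where k: "k \<le> m" "uniform_strategy ?D k s"
    "\<And>l. l < k \<Longrightarrow> fst (s ! l) = avg_value ?v (quantity_upto s (Suc l))"
    unfolding safe_class_def length_hard_valuation[OF D] by blast
  let ?Q = "\<lambda>l. quantity_upto s (Suc l)"
  let ?f = "\<lambda>l g. if ?Q l \<le> N ^ g then real (?Q l) + 1 else 0"
  have "total_value ?K ?v ?H s \<le> (\<Sum>g=1..n. real (N ^ (n - g)) * (\<Sum>l<k. ?f l g))"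
    unfolding total_value_hard_history
  proof (intro sum_mono mult_left_mono)
    fix g assume g: "g \<in> {1..n}"
    have "N ^ g \<le> ?D" using N g by (intro power_increasing) simp_all
    then show "obtained_value ?K ?v s (hard_bids ?K g (N ^ g)) \<le> (\<Sum>l<k. ?f l g)"
      using N by (intro obtained_value_safe_hard_bids k D) (simp_all add: le_SucI)
  qed simp
  also have "\<dots> = (\<Sum>l<k. \<Sum>g=1..n. real (N ^ (n - g)) * ?f l g)"
    unfolding sum_distrib_left by (rule sum.swap)
  finally have "(real N - 1) * total_value ?K ?v ?H s
      \<le> (real N - 1) * (\<Sum>l<k. \<Sum>g=1..n. real (N ^ (n - g)) * ?f l g)"
    using N by (intro mult_left_mono) auto
  also have "\<dots> = (\<Sum>l<k. (real N - 1) * (\<Sum>g=1..n. real (N ^ (n - g)) * ?f l g))"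
    by (rule sum_distrib_left)
  also have "\<dots> \<le> (\<Sum>l<k. real ?D * (real N + 1))"
  proof (rule sum_mono)
    fix l assume "l \<in> {..<k}"
    then have "?Q l \<ge> 1" using quantity_upto_pos[OF k(2), of l] by simp
    then show "(real N - 1) * (\<Sum>g=1..n. real (N ^ (n - g)) * ?f l g) \<le> real ?D * (real N + 1)"
      by (rule level_contribution[OF N])
  qed
  also have "\<dots> = real k * (real ?D * (real N + 1))" by simp
  also have "\<dots> \<le> real m * (real ?D * (real N + 1))"
    using k(1) by (intro mult_right_mono) auto
  finally show ?thesis unfolding best .
qed

text \<open>Block \<open>l\<close> bids the average at \<open>N ^ (2 * l + 1)\<close> but extends to
  cumulative quantity \<open>N ^ (2 * l + 2)\<close>, where the average is lower. It is therefore
  not safe, and this gap between the two powers lets it serve two groups.\<close>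

definition rich_strategy :: "nat \<Rightarrow> nat \<Rightarrow> strategy" where
  "rich_strategy N m' =
     strategy_of m' (\<lambda>l. 1 + 1 / real (N ^ (2 * l + 1))) (\<lambda>l. N ^ (2 * l + 2))"

lemma inverse_power_less_iff:
  assumes "N \<ge> (2::nat)"
  shows "1 / real (N ^ i) < 1 / real (N ^ j) \<longleftrightarrow> j < i"
    "1 / real (N ^ i) \<le> 1 / real (N ^ j) \<longleftrightarrow> j \<le> i"
  using assms by (simp_all add: divide_simps)

lemma quantity_upto_rich_strategy:
  assumes "N \<ge> 2" "l < m'"
  shows "quantity_upto (rich_strategy N m') (Suc l) = N ^ (2 * l + 2)"
  unfolding rich_strategy_def
  by (rule quantity_upto_strategy_of)
    (use assms in \<open>auto intro: power_strict_increasing simp del: power_Suc\<close>)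

lemma uniform_rich_strategy:
  assumes N: "N \<ge> 2" and m': "m' \<ge> 1"
  shows "uniform_strategy (N ^ (2 * m')) m' (rich_strategy N m')"
  unfolding rich_strategy_def
proof (rule uniform_strategy_of[OF m'])
  show "1 + 1 / real (N ^ (2 * l + 1)) < 1 + 1 / real (N ^ (2 * i + 1))" if "i < l" for i l
    using inverse_power_less_iff(1)[OF N, of "2 * l + 1" "2 * i + 1"] that by simp
  show "N ^ (2 * (m' - 1) + 2) \<le> N ^ (2 * m')" using N m' by (intro power_increasing) auto
  show "N ^ (2 * i + 2) < N ^ (2 * Suc i + 2)" for i
    using N by (intro power_strict_increasing) auto
qed (use N in \<open>simp_all add: add_pos_nonneg\<close>)

text \<open>Group \<open>2 * i + 1\<close> exhausts part of block \<open>i\<close>, group \<open>2 * i + 2\<close> all of it.\<close>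

lemma rich_strategy_hard_bids:
  assumes N: "N \<ge> 2" and g: "1 \<le> g" "g \<le> 2 * m'"
  defines "K \<equiv> N ^ (2 * m') + 1" and "y \<equiv> N ^ g" and "bs \<equiv> bid_vector (rich_strategy N m')"
  shows "units_won K bs (hard_bids K g y) = y" (is ?units)
    and "price K bs (hard_bids K g y) \<le> 1 + 1 / real y" (is ?price)
proof -
  let ?s = "rich_strategy N m'" and ?r = "1 + 1 / real y" and ?\<beta> = "hard_bids K g y"
  \<comment> \<open>The block that serves group \<open>g\<close>, counted from 0.\<close>
  define i where "i = (g - 1) div 2"
  have i: "i < m'" "g = (if odd g then 2 * i + 1 else 2 * i + 2)"
    using g by (auto simp: i_def elim!: oddE evenE)
  have m': "m' \<ge> 1" using g by simp
  note s = uniform_rich_strategy[OF N m']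
  have y: "1 \<le> y" "y \<le> K" "y < K"
    using N g power_increasing[of g "2 * m'" N] unfolding y_def K_def by (simp_all add: le_SucI less_Suc_eq_le)
  have K: "K \<ge> 1" by (simp add: K_def)
  note ge = num_ge_hard_bids[OF y(1,2), of g] and gt = num_gt_hard_bids[OF y(1,2), of g]
  have bid: "fst (?s ! l) = 1 + 1 / real (N ^ (2 * l + 1))" if "l < m'" for l
    using that by (simp add: rich_strategy_def fst_strategy_of)
  have own_ge: "num (\<lambda>c. ?r \<le> c) bs = N ^ (2 * i + 2)"
  proof -
    obtain j where j: "j \<le> m'" "\<forall>l<m'. ?r \<le> fst (?s ! l) \<longleftrightarrow> l < j"
      "num (\<lambda>c. ?r \<le> c) bs = quantity_upto ?s j"
      unfolding bs_def using num_ge_bid_vector[OF s] by metis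
    have iff: "l < j \<longleftrightarrow> l \<le> i" if "l < m'" for l
    proof -
      have "l < j \<longleftrightarrow> ?r \<le> fst (?s ! l)" using j(2) that by blast
      also have "\<dots> \<longleftrightarrow> 2 * l + 1 \<le> g"
        using bid[OF that] inverse_power_less_iff(2)[OF N, of g "2 * l + 1"]
        by (simp add: y_def)
      also have "\<dots> \<longleftrightarrow> l \<le> i" using i(2) by (auto split: if_splits)
      finally show ?thesis .
    qed
    have "j = Suc i"
      using iff[of i] iff[of "Suc i"] i(1) j(1) by (cases "Suc i < m'") auto
    then show ?thesis using j(3) quantity_upto_rich_strategy[OF N i(1)] by simp
  qed
  have own_gt: "num (\<lambda>c. ?r < c) bs < y" if "odd g"
  proof -
    obtain j where j: "j \<le> m'" "\<And>l. l < m' \<Longrightarrow> ?r < fst (?s ! l) \<longleftrightarrow> l < j"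
      "num (\<lambda>c. ?r < c) bs = quantity_upto ?s j"
      unfolding bs_def by (rule num_bid_vector_upclosed[OF s, of "\<lambda>c. ?r < c"]) (simp, blast)
    show ?thesis
    proof (cases j)
      case 0
      then show ?thesis using j(3) y by (simp add: quantity_upto_def)
    next
      case (Suc l)
      then have l: "l < m'" using j(1) by simp
      then have "2 * l + 1 < g"
        using j(2)[OF l] Suc bid[OF l] inverse_power_less_iff(1)[OF N, of g "2 * l + 1"]
        by (simp add: y_def)
      \<comment> \<open>Both \<open>2 * l + 1\<close> and \<open>g\<close> are odd, so they differ
        by at least 2: block \<open>l\<close> ends before \<open>N ^ g\<close>.\<close>
      then have "2 * l + 2 < g" using that by presburger
      then have "N ^ (2 * l + 2) < N ^ g" using N by (intro power_strict_increasing) auto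
      then show ?thesis
        using j(3) Suc quantity_upto_rich_strategy[OF N l] by (simp add: y_def)
    qed
  qed
  have y_le: "y \<le> N ^ (2 * i + 2)"
    unfolding y_def using N i(2) by (intro power_increasing) (auto split: if_splits)
  have y_eq: "N ^ (2 * i + 2) = y" if "even g"
    using i(2) that by (simp add: y_def)
  show price: ?price
  proof (rule price_le[OF K])
    show "num (\<lambda>c. ?r < c) bs + num (\<lambda>c. ?r < c) ?\<beta> < K"
    proof (cases "odd g")
      case True
      then show ?thesis using own_gt gt y by simp
    next
      case False
      have "num (\<lambda>c. ?r < c) bs \<le> num (\<lambda>c. ?r \<le> c) bs" by (rule num_mono) simp
      then show ?thesis using False own_ge y_eq gt y by simp
    qed
  qed simp
  have "y \<le> units_won K bs ?\<beta>"
    by (rule units_won_ge[where r = ?r]) (use own_ge y_le gt y in simp_all)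
  \<comment> \<open>For odd \<open>g\<close> the \<open>K - y\<close> bids of 3 exceed the price and
    leave only \<open>y\<close> units; for even \<open>g\<close> exactly \<open>y\<close> own bids
    reach the competing bids.\<close>
  moreover have "units_won K bs ?\<beta> \<le> y"
  proof (cases "odd g")
    case True
    have "num (\<lambda>c. ?r < c) ?\<beta> \<le> num (\<lambda>c. price K bs ?\<beta> < c) ?\<beta>"
      by (rule num_mono) (use price in simp)
    then show ?thesis using units_won_add_num_gt_price[OF K, of bs ?\<beta>] True gt y by simp
  next
    case False
    then show ?thesis using units_won_le[of K ?r ?\<beta> bs] ge own_ge y_eq by simp
  qed
  ultimately show ?units by simp
qed

text \<open>Winning exactly \<open>N ^ g\<close> units at a price of at most their average makes
  \<open>rich_strategy\<close> feasible, and each of the \<open>2 * m'\<close> groups yields at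
  least \<open>N ^ (n - g) * N ^ g = N ^ n\<close>.\<close>

lemma best_roi_feasible_hard_ge:
  assumes N: "N \<ge> 2" and m': "m' \<ge> 1"
  defines "n \<equiv> 2 * m'"
  shows "real n * real (N ^ n) \<le>
    best_value (roi_feasible_class m') (N ^ n + 1) (hard_valuation (N ^ n)) (hard_history N n)"
proof -
  let ?D = "N ^ n" and ?K = "N ^ n + 1" and ?H = "hard_history N n" and ?s = "rich_strategy N m'"
  let ?v = "hard_valuation ?D"
  have D: "?D \<ge> 1" using N by simp
  have y: "1 \<le> N ^ g" "N ^ g \<le> ?D" if "g \<in> {1..n}" for g
    using N that by (simp_all add: power_increasing)
  have units: "units_won ?K (bid_vector ?s) (hard_bids ?K g (N ^ g)) = N ^ g"
    and price: "price ?K (bid_vector ?s) (hard_bids ?K g (N ^ g)) \<le> 1 + 1 / real (N ^ g)"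
    if "g \<in> {1..n}" for g
    using rich_strategy_hard_bids[OF N, of g m'] that by (simp_all add: n_def)
  have "payment ?K ?s \<beta> \<le> obtained_value ?K ?v ?s \<beta>" if in_H: "\<beta> \<in> set ?H" for \<beta>
  proof -
    obtain g where g: "g \<in> {1..n}" and \<beta>: "\<beta> = hard_bids ?K g (N ^ g)"
      using set_hard_history[OF in_H] by blast
    show ?thesis
      unfolding \<beta> by (rule payment_le_obtained_value)
        (simp only: units[OF g] avg_value_hard_valuation[OF y[OF g]] price[OF g])
  qed
  moreover have "uniform_strategy (length ?v) m' ?s"
    unfolding length_hard_valuation[OF D] unfolding n_def by (rule uniform_rich_strategy[OF N m'])
  ultimately have "?s \<in> roi_feasible_class m' ?K ?v ?H"
    unfolding roi_feasible_class_def by blast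
  then have le: "total_value ?K ?v ?H ?s \<le> best_value (roi_feasible_class m') ?K ?v ?H"
    by (rule total_value_le_best_value)
  have "(\<Sum>g=1..n. real ?D) \<le> total_value ?K ?v ?H ?s"
    unfolding total_value_hard_history
  proof (rule sum_mono)
    fix g assume g: "g \<in> {1..n}"
    have "real ?D = real (N ^ (n - g)) * real (N ^ g)"
      using g by (simp flip: power_add of_nat_mult of_nat_power)
    also have "\<dots> \<le> real (N ^ (n - g)) * (real (N ^ g) + 1)"
      by (intro mult_left_mono) auto
    also have "real (N ^ g) + 1 = obtained_value ?K ?v ?s (hard_bids ?K g (N ^ g))"
      unfolding obtained_value_def units[OF g] by (rule value_upto_hard_valuation[OF y[OF g], symmetric])
    finally show "real ?D \<le> real (N ^ (n - g)) * obtained_value ?K ?v ?s (hard_bids ?K g (N ^ g))" .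
  qed
  then show ?thesis using le by simp
qed

lemma value_ratio_hard_ge:
  fixes \<delta> :: real
  assumes m: "1 \<le> m" "m \<le> m'" and \<delta>: "\<delta> > 0"
  shows "\<exists>K v H. auction_instance K v H \<and>
    value_ratio (roi_feasible_class m') (safe_class m) K v H \<ge> 2 * real m' / real m - \<delta>"
proof -
  \<comment> \<open>The bounds give a ratio of at least
    \<open>(2 * m' / m) * (N - 1) / (N + 1)\<close>; \<open>N \<ge> 4 * m' / \<delta>\<close> makes
    the loss at most \<open>\<delta>\<close>.\<close>
  define N where "N = nat \<lceil>4 * real m' / \<delta>\<rceil> + 2"
  define n where "n = 2 * m'"
  let ?D = "N ^ n"
  let ?v = "hard_valuation ?D" and ?H = "hard_history N n"
  let ?A = "best_value (roi_feasible_class m') (?D + 1) ?v ?H"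
  let ?B = "best_value (safe_class m) (?D + 1) ?v ?H"
  have N: "N \<ge> 2" by (simp add: N_def)
  have "4 * real m' / \<delta> \<le> real N" unfolding N_def by linarith
  then have N\<delta>: "4 * real m' \<le> real N * \<delta>" using \<delta> by (simp add: field_simps)
  have D: "real ?D > 0" using N by simp
  have inst: "auction_instance (?D + 1) ?v ?H"
    using auction_instance_hard[OF N] m by (simp add: n_def)
  have A: "2 * real m' * real ?D \<le> ?A"
    using best_roi_feasible_hard_ge[OF N, of m'] m by (simp add: n_def)
  have B: "(real N - 1) * ?B \<le> real m * (real ?D * (real N + 1))"
    by (rule best_safe_hard_le[OF m(1) N])
  \<comment> \<open>The safe optimum is positive by the upper bound itself, because the RoI feasible
    optimum is; the quotient is thus a genuine one.\<close>
  have "0 < 2 * real m' * real ?D" using D m by simp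
  then have "0 < real m * ?A" using A m by (intro mult_pos_pos) auto
  then have "0 < 2 * real m' * ?B" using best_roi_feasible_le[OF m inst] by linarith
  then have Bpos: "?B > 0" using m by (simp add: zero_less_mult_iff)
  have "2 * real m' / real m - \<delta> \<le> ?A / ?B"
  \<comment> \<open>Multiplying the bound on \<open>?B\<close> by the target ratio requires that
    target to be nonnegative.\<close>
  proof (cases "2 * real m' / real m - \<delta> \<le> 0")
    case True
    then show ?thesis using A Bpos by (smt (verit) divide_nonneg_pos D of_nat_0_le_iff mult_nonneg_nonneg)
  next
    case False
    let ?c = "2 * real m' / real m - \<delta>"
    have "real m * ?c = 2 * real m' - real m * \<delta>" using m by (simp add: field_simps)
    also have "\<dots> \<le> 2 * real m' - \<delta>" using m \<delta> by simp
    finally have mc: "real m * ?c \<le> 2 * real m' - \<delta>" .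
    have "(2 * real m' - \<delta>) * (real N + 1) \<le> 2 * real m' * (real N - 1)"
      using N\<delta> \<delta> by (simp add: algebra_simps)
    moreover have "real m * ?c * (real N + 1) \<le> (2 * real m' - \<delta>) * (real N + 1)"
      using mc by (rule mult_right_mono) simp
    ultimately have key: "real m * ?c * (real N + 1) \<le> 2 * real m' * (real N - 1)" by linarith
    have "(real N - 1) * (?c * ?B) = ?c * ((real N - 1) * ?B)" by simp
    also have "\<dots> \<le> ?c * (real m * (real ?D * (real N + 1)))"
      using B False by (intro mult_left_mono) auto
    also have "\<dots> = real ?D * (real m * ?c * (real N + 1))" by simp
    also have "\<dots> \<le> real ?D * (2 * real m' * (real N - 1))"
      using key D by (intro mult_left_mono) auto
    also have "\<dots> = (real N - 1) * (2 * real m' * real ?D)" by simp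
    also have "\<dots> \<le> (real N - 1) * ?A" using A N by (intro mult_left_mono) auto
    finally have "?c * ?B \<le> ?A" using N by simp
    then show ?thesis using Bpos by (simp add: pos_le_divide_eq)
  qed
  with inst show ?thesis unfolding value_ratio_def by blast
qed

theorem mainTheorem10:
  fixes m m' :: nat
  assumes "m \<ge> 1" and "m' \<ge> m"
  shows "worst_case_ratio (roi_feasible_class m') (safe_class m) \<le> ereal (2 * real m' / real m) \<and>
    (\<forall>\<delta>::real. 0 < \<delta> \<and> \<delta> \<le> 1 / 2 \<longrightarrow>
       (\<exists>K v H. auction_instance K v H \<and>
          value_ratio (roi_feasible_class m') (safe_class m) K v H \<ge> 2 * real m' / real m - \<delta>)) \<and>
    richness_ratio (roi_feasible_class m') m (real m / (2 * real m'))"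
proof (intro conjI)
  show upper: "worst_case_ratio (roi_feasible_class m') (safe_class m) \<le> ereal (2 * real m' / real m)"
    by (rule worst_case_ratio_le[OF assms])
  show lower: "\<forall>\<delta>::real. 0 < \<delta> \<and> \<delta> \<le> 1 / 2 \<longrightarrow>
       (\<exists>K v H. auction_instance K v H \<and>
          value_ratio (roi_feasible_class m') (safe_class m) K v H \<ge> 2 * real m' / real m - \<delta>)"
    using value_ratio_hard_ge[OF assms] by blast
  have "2 * real m' / real m > 0" "real m / (2 * real m') = 1 / (2 * real m' / real m)"
    using assms by simp_all
  moreover have "(1 / 2 :: real) > 0" by simp
  ultimately show "richness_ratio (roi_feasible_class m') m (real m / (2 * real m'))"
    unfolding richness_ratio_def using upper lower by blast
qed

end
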